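(* Let $f:\mathbb R^m\to\mathbb R\cup\{\infty\}$, $g:\mathbb R^n\to\mathbb R\cup\{\infty\}$, $A\in\mathbb R^{p\times m}$, $B\in\mathbb R^{p\times n}$, $b\in\mathbb R^p$. Let $\lambda>0$ and let $\beta>0$ be large enough that any ADMM minimization subproblem has solutions, i.e. $\operatorname{argmin}\{f+\frac\beta2\|A\cdot-s\|^2\}$ and $\operatorname{argmin}\{g+\frac\beta2\|B\cdot-s\|^2\}$ are nonempty for all $s\in\mathbb R^p$. Starting from $(x,y,z)\in\mathbb R^m\times\mathbb R^p\times\mathbb R^n$, let $(x^+,y^+,z^+)$ be obtained by one ADMM update with relaxation $\lambda$ and penalty $\beta$. Let $$s=Ax-y/\beta,\quad u=Ax,\quad v=b-Bz,\qquad s^+=Ax^+-y^+/\beta,\quad u^+=Ax^+,\quad v^+=b-Bz^+,$$ and let $\varphi_1=(Af)$, $\varphi_2=(Bg)(b-\,\cdot\,)$, $\gamma=1/\beta$. Then $$s^+=s+\lambda(v-u),\qquad u^+\in\operatorname{prox}_{\gamma\varphi_1}(s^+),\qquad v^+\in\operatorname{prox}_{\gamma\varphi_2}(2u^+-s^+).$$ Moreover: (i) $\varphi_1(u^+)=(Af)(Ax^+)=f(x^+)$; (ii) $\varphi_2(v^+)=(Bg)(Bz^+)=g(z^+)$; (iii) $-y^+\in\hat\partial\varphi_1(u^+)=\hat\partial(Af)(Ax^+)$; (iv) $-A^{\top}y^+\in\hat\partial f(x^+)$; (v) $\operatorname{dist}(-B^{\top}y^+,\hat\partial g(z^+))\le\beta\|B\|\,\|Ax^++Bz^+-b\|$.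 If, additionally, $A$ has full row rank, $\varphi_1$ is $L_{\varphi_1}$-smooth on $\mathbb R^p$ (differentiable with $L_{\varphi_1}$-Lipschitz gradient), and $\beta>L_{\varphi_1}$, then also (vi) $\varphi_\gamma^{\rm dr}(s^+)=\mathcal L_\beta(x^+,z^+,y^+)$.
   Context: Augmented Lagrangian: $\mathcal L_\beta(x,z,y)=f(x)+g(z)+\langle y,Ax+Bz-b\rangle+\frac\beta2\|Ax+Bz-b\|^2$. One ADMM update: $y^{+/2}=y-\beta(1-\lambda)(Ax+Bz-b)$; $x^+\in\operatorname{argmin}\mathcal L_\beta(\cdot,z,y^{+/2})$; $y^+=y^{+/2}+\beta(Ax^++Bz-b)$; $z^+\in\operatorname{argmin}\mathcal L_\beta(x^+,\cdot,y^+)$. Image function: for $h:\mathbb R^n\to\mathbb R\cup\{\infty\}$ and $C\in\mathbb R^{p\times n}$, $(Ch)(s)=\inf\{h(x):Cx=s\}$, with values in $[-\infty,\infty]$. $\operatorname{prox}_{\gamma h}(x)=\operatorname{argmin}_w\{h(w)+\frac1{2\gamma}\|w-x\|^2\}$ (possibly set-valued). Here $\operatorname{argmin}$ denotes the set of points attaining a finite minimum. Regular subdifferential: $v\in\hat\partial h(\bar x)$ iff $\liminf_{x\to\bar x,\,x\ne\bar x}\frac{h(x)-h(\bar x)-\langle v,x-\bar x\rangle}{\|x-\bar x\|}\ge0$. Douglas-Rachford envelope (for $\gamma<1/L_{\varphi_1}$): with $u=\operatorname{prox}_{\gamma\varphi_1}(s)$, $\varphi_\gamma^{\rm dr}(s)=\min_{w\in\mathbb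 R^p}\{\varphi_2(w)+\varphi_1(u)+\langle\nabla\varphi_1(u),w-u\rangle+\frac1{2\gamma}\|w-u\|^2\}$. *)

theory Defs
  imports "HOL-Analysis.Analysis"
begin

text \<open>Functions with values in \<open>\<real> \<union> {\<infinity>}\<close> are \<open>ereal\<close>-valued functions
  that never take the value \<open>-\<infinity>\<close>; functions with values in \<open>[-\<infinity>, \<infinity>]\<close> are
  unrestricted \<open>ereal\<close>-valued functions.\<close>

definition argmin :: "('a \<Rightarrow> ereal) \<Rightarrow> 'a set" where
  "argmin F = {x. \<bar>F x\<bar> \<noteq> \<infinity> \<and> (\<forall>y. F x \<le> F y)}"

definition coupling ::
  "real \<Rightarrow> real^'m^'p \<Rightarrow> real^'n^'p \<Rightarrow> real^'p \<Rightarrow> real^'m \<Rightarrow> real^'n \<Rightarrow> real^'p \<Rightarrow> real" where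
  "coupling \<beta> A B b x z y =
     y \<bullet> (A *v x + B *v z - b) + \<beta> / 2 * (norm (A *v x + B *v z - b))\<^sup>2"

definition aug_lagrangian ::
  "real \<Rightarrow> (real^'m \<Rightarrow> ereal) \<Rightarrow> (real^'n \<Rightarrow> ereal) \<Rightarrow> real^'m^'p \<Rightarrow> real^'n^'p \<Rightarrow> real^'p \<Rightarrow>
   real^'m \<Rightarrow> real^'n \<Rightarrow> real^'p \<Rightarrow> ereal" where
  "aug_lagrangian \<beta> f g A B b x z y = f x + g z + ereal (coupling \<beta> A B b x z y)"

text \<open>The relation between \<open>(x, z, y)\<close> and a possible next iterate \<open>(x', z', y')\<close> (the
  minimizers need not be unique). A starting point with \<open>g z = \<infinity>\<close> is allowed: there the
  augmented Lagrangian is identically \<open>\<infinity>\<close> in its first argument, and the term \<open>g z\<close>, constant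
  for the minimization over that argument, is dropped.\<close>

definition admm_update ::
  "real \<Rightarrow> real \<Rightarrow> (real^'m \<Rightarrow> ereal) \<Rightarrow> (real^'n \<Rightarrow> ereal) \<Rightarrow>
   real^'m^'p \<Rightarrow> real^'n^'p \<Rightarrow> real^'p \<Rightarrow>
   real^'m \<Rightarrow> real^'n \<Rightarrow> real^'p \<Rightarrow> real^'m \<Rightarrow> real^'n \<Rightarrow> real^'p \<Rightarrow> bool" where
  "admm_update lam \<beta> f g A B b x z y x' z' y' \<longleftrightarrow>
     (\<exists>y2. y2 = y - (\<beta> * (1 - lam)) *\<^sub>R (A *v x + B *v z - b) \<and>
       x' \<in> argmin (\<lambda>\<xi>. if g z = \<infinity> then f \<xi> + ereal (coupling \<beta> A B b \<xi> z y2)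
                          else aug_lagrangian \<beta> f g A B b \<xi> z y2) \<and>
       y' = y2 + \<beta> *\<^sub>R (A *v x' + B *v z - b) \<and>
       z' \<in> argmin (\<lambda>\<zeta>. aug_lagrangian \<beta> f g A B b x' \<zeta> y'))"

definition image_fun :: "real^'n^'p \<Rightarrow> (real^'n \<Rightarrow> ereal) \<Rightarrow> real^'p \<Rightarrow> ereal" where
  "image_fun C h s = (INF x\<in>{x. C *v x = s}. h x)"

definition prox :: "real \<Rightarrow> ('a::real_normed_vector \<Rightarrow> ereal) \<Rightarrow> 'a \<Rightarrow> 'a set" where
  "prox \<gamma> h x = argmin (\<lambda>w. h w + ereal (1 / (2 * \<gamma>) * (norm (w - x))\<^sup>2))"

text \<open>As usual, the subdifferential is empty at points where the function is not finite.\<close>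

definition regular_subdiff :: "('a::real_inner \<Rightarrow> ereal) \<Rightarrow> 'a \<Rightarrow> 'a set" where
  "regular_subdiff h xb = {v. \<bar>h xb\<bar> \<noteq> \<infinity> \<and>
     Liminf (at xb) (\<lambda>x. (h x - h xb - ereal (v \<bullet> (x - xb))) / ereal (norm (x - xb))) \<ge> 0}"

text \<open>Unlike \<^const>\<open>infdist\<close>, this is \<open>\<infinity>\<close> (not \<open>0\<close>) for the empty set.\<close>

definition edist_set :: "'a::metric_space \<Rightarrow> 'a set \<Rightarrow> ereal" where
  "edist_set x S = (INF w\<in>S. ereal (dist x w))"

definition grad :: "('a::real_inner \<Rightarrow> ereal) \<Rightarrow> 'a \<Rightarrow> 'a" where
  "grad h x = (THE D. GDERIV (\<lambda>w. real_of_ereal (h w)) x :> D)"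

definition L_smooth :: "real \<Rightarrow> ('a::real_inner \<Rightarrow> ereal) \<Rightarrow> bool" where
  "L_smooth L h \<longleftrightarrow> (\<forall>x. \<bar>h x\<bar> \<noteq> \<infinity>) \<and>
     (\<forall>x. \<exists>D. GDERIV (\<lambda>w. real_of_ereal (h w)) x :> D) \<and>
     L-lipschitz_on UNIV (grad h)"

text \<open>Meaningful for \<open>\<gamma> < 1 / L\<close> with \<open>\<phi>1\<close> \<open>L\<close>-smooth, where the proximal map
  of \<open>\<phi>1\<close> is at most single-valued. The value of a minimum is the least attained value.\<close>

definition dr_envelope ::
  "real \<Rightarrow> ('a::real_inner \<Rightarrow> ereal) \<Rightarrow> ('a \<Rightarrow> ereal) \<Rightarrow> 'a \<Rightarrow> ereal" where
  "dr_envelope \<gamma> \<phi>1 \<phi>2 s =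
     (let u = the_elem (prox \<gamma> \<phi>1 s) in
      LEAST t. t \<in> range (\<lambda>w. \<phi>2 w + \<phi>1 u +
        ereal (grad \<phi>1 u \<bullet> (w - u) + 1 / (2 * \<gamma>) * (norm (w - u))\<^sup>2)))"

end

theory Submission
  imports Defs
begin

text \<open>
  Completing the square in the multiplier terms turns each half of the ADMM update into a purely
  quadratic penalty problem: with \<open>sp = A *v xp - yp /\<^sub>R \<beta>\<close>, the point \<open>xp\<close> minimizes
  \<open>f \<xi> + \<beta>/2 \<parallel>A \<xi> - sp\<parallel>\<^sup>2\<close> and \<open>zp\<close> minimizes \<open>g \<zeta> + \<beta>/2 \<parallel>B \<zeta> - (b - (2 up - sp))\<parallel>\<^sup>2\<close>
  (\<open>argmin_aug_lagrangian_x\<close>, \<open>argmin_aug_lagrangian_z\<close>). The first holds because the target of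
  the penalty is expressed through the half-step multiplier, and adding \<open>\<beta>\<close> times the new residual
  makes it \<open>A xp - yp / \<beta>\<close>; the relaxation step \<open>sp = s + lam (v - u)\<close> is the same identity
  written in the old iterate.

  The remaining claims are consequences of these two minimizations. A penalty that sees \<open>x\<close>
  only through \<open>C x\<close> is constant on the fibres of \<open>C\<close>, so a minimizer of the penalized problem is
  minimal for \<open>h\<close> itself in its fibre, and its image minimizes the same penalty added to the image
  function (\<open>image_fun_eq_at_argmin\<close>, \<open>image_argmin\<close>). This gives the two prox inclusions and the
  values of \<open>\<phi>1\<close> and \<open>\<phi>2\<close>. Fermat's rule for the sum of a function and a differentiable penalty
  (\<open>regular_subdiff_argmin\<close>) gives the subgradients. At \<open>xp\<close> the gradient of the penalty is exactly
  \<open>A\<^sup>T yp\<close>, while at \<open>zp\<close> it is \<open>B\<^sup>T (yp + \<beta> r)\<close> with \<open>r\<close> the new residual, and the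
  discrepancy \<open>\<beta> B\<^sup>T r\<close> is the bound on the distance.

  For the envelope, two distinct points of \<open>prox \<gamma> \<phi>1 sp\<close> would have gradients differing by exactly \<open>\<beta>\<close>
  times their distance, which exceeds the Lipschitz bound; hence the prox is the single point
  \<open>up\<close>, where the gradient of \<open>\<phi>1\<close> is \<open>- yp\<close>. The function minimized in the envelope then
  differs by a constant from the one whose minimizer is \<open>vp\<close>, and its value at \<open>vp\<close> is the
  augmented Lagrangian.
\<close>

section \<open>Minimizers of penalized functions\<close>

text \<open>Moving the real penalty to one side separates finiteness and minimality of \<open>h\<close> from
  arithmetic with infinite values, which is delicate in \<^typ>\<open>ereal\<close>.\<close>

lemma argmin_add_ereal_iff:
  "w \<in> argmin (\<lambda>x. h x + ereal (q x)) \<longleftrightarrow>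
     \<bar>h w\<bar> \<noteq> \<infinity> \<and> (\<forall>x. h w + ereal (q w - q x) \<le> h x)"
proof -
  have "(h w + ereal (q w) \<le> h x + ereal (q x)) = (h w + ereal (q w - q x) \<le> h x)" for x
    by (cases "h w"; cases "h x") auto
  moreover have "\<bar>h w + ereal (q w)\<bar> \<noteq> \<infinity> \<longleftrightarrow> \<bar>h w\<bar> \<noteq> \<infinity>"
    by (cases "h w") auto
  ultimately show ?thesis
    by (simp add: argmin_def)
qed

lemma argmin_add_const:
  assumes "\<bar>c\<bar> \<noteq> \<infinity>"
  shows "argmin (\<lambda>x. F x + c) = argmin F"
proof -
  obtain r where r: "c = ereal r" using assms by (cases c) auto
  have "(F x + c \<le> F y + c) = (F x \<le> F y)" for x y
    unfolding r by (cases "F x"; cases "F y") auto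
  moreover have "\<bar>F x + c\<bar> \<noteq> \<infinity> \<longleftrightarrow> \<bar>F x\<bar> \<noteq> \<infinity>" for x
    unfolding r by (cases "F x") auto
  ultimately show ?thesis by (simp add: argmin_def)
qed

text \<open>This is where the multiplier \<open>y\<close> becomes a shift of the target of the penalty by \<open>y / \<beta>\<close>.\<close>

lemma complete_square:
  fixes y r :: "'a::real_inner"
  assumes "\<beta> > 0"
  shows "y \<bullet> r + \<beta> / 2 * (norm r)\<^sup>2
       = \<beta> / 2 * (norm (r + y /\<^sub>R \<beta>))\<^sup>2 - (norm y)\<^sup>2 / (2 * \<beta>)"
  using assms unfolding power2_norm_eq_inner
  by (simp add: inner_add_left inner_add_right inner_commute field_simps
      power2_eq_square)

text \<open>All points of one fibre of \<open>C\<close> carry the same penalty, so on the fibre of the minimizer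
  the comparison of penalized values is a comparison of values of \<open>h\<close>.\<close>

lemma image_fun_eq_at_argmin:
  assumes "w \<in> argmin (\<lambda>x. h x + ereal (q (C *v x)))"
  shows "image_fun C h (C *v w) = h w"
  unfolding image_fun_def
proof (rule antisym)
  show "(INF x\<in>{x. C *v x = C *v w}. h x) \<le> h w"
    by (rule INF_lower) simp
  show "h w \<le> (INF x\<in>{x. C *v x = C *v w}. h x)"
  proof (rule INF_greatest)
    fix x assume x: "x \<in> {x. C *v x = C *v w}"
    have "h w + ereal (q (C *v w) - q (C *v x)) \<le> h x"
      using assms unfolding argmin_add_ereal_iff by blast
    with x show "h w \<le> h x" by simp
  qed
qed

text \<open>The lower bound on \<open>h x\<close> that minimality provides depends on \<open>x\<close> only through \<open>C *v x\<close>,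
  so it survives the infimum over a fibre. An empty fibre contributes the value \<open>\<infinity>\<close>.\<close>

lemma image_argmin:
  assumes "w \<in> argmin (\<lambda>x. h x + ereal (q (C *v x)))"
  shows "C *v w \<in> argmin (\<lambda>t. image_fun C h t + ereal (q t))"
  unfolding argmin_add_ereal_iff image_fun_eq_at_argmin[OF assms]
proof (intro conjI allI)
  show "\<bar>h w\<bar> \<noteq> \<infinity>"
    using assms unfolding argmin_add_ereal_iff by (rule conjunct1)
  fix t
  show "h w + ereal (q (C *v w) - q t) \<le> image_fun C h t"
    unfolding image_fun_def
  proof (rule INF_greatest)
    fix x assume "x \<in> {x. C *v x = t}"
    then show "h w + ereal (q (C *v w) - q t) \<le> h x"
      using assms unfolding argmin_add_ereal_iff by blast
  qed
qed

section \<open>Fermat's rule for the regular subdifferential\<close>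

text \<open>Minimality bounds the increment of \<open>h\<close> below by that of \<open>- q\<close>, which is linear with slope
  \<open>- d\<close> up to an error \<open>o(\<parallel>x - w\<parallel>)\<close>; so the difference quotient in the definition of the
  regular subdifferential has a lower bound tending to \<open>0\<close>.\<close>

lemma regular_subdiff_argmin:
  fixes h :: "'a::real_inner \<Rightarrow> ereal"
  assumes min: "w \<in> argmin (\<lambda>x. h x + ereal (q x))"
    and deriv: "GDERIV q w :> d"
  shows "- d \<in> regular_subdiff h w"
proof -
  define e where "e x = (q x - q w - (x - w) \<bullet> d) / norm (x - w)" for x
  have fin: "\<bar>h w\<bar> \<noteq> \<infinity>" and le: "h w + ereal (q w - q x) \<le> h x" for x
    using min unfolding argmin_add_ereal_iff by auto
  have "(e \<longlongrightarrow> 0) (at w)"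
    using deriv unfolding gderiv_def has_derivative_iff_norm e_def
    by (subst tendsto_rabs_zero_iff[symmetric]) (simp add: abs_divide)
  then have lim: "((\<lambda>x. ereal (- e x)) \<longlongrightarrow> ereal 0) (at w)"
    by (intro tendsto_intros) (auto intro: tendsto_eq_intros)
  have bound: "ereal (- e x) \<le> (h x - h w - ereal (- d \<bullet> (x - w))) / ereal (norm (x - w))"
    if "x \<noteq> w" for x
  proof -
    have "ereal (- e x) = ereal (- (q x - q w - (x - w) \<bullet> d)) / ereal (norm (x - w))"
      unfolding e_def minus_divide_left using that by simp
    also have "\<dots> \<le> (h x - h w - ereal (- d \<bullet> (x - w))) / ereal (norm (x - w))"
    proof (rule ereal_divide_right_mono)
      show "ereal (- (q x - q w - (x - w) \<bullet> d)) \<le> h x - h w - ereal (- d \<bullet> (x - w))"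
        using fin le[of x] by (cases "h x"; cases "h w") (auto simp: inner_commute)
      show "0 < ereal (norm (x - w))"
        using that by simp
    qed
    finally show ?thesis .
  qed
  have "0 \<le> Liminf (at w) (\<lambda>x. (h x - h w - ereal (- d \<bullet> (x - w))) / ereal (norm (x - w)))"
    unfolding le_Liminf_iff
  proof (intro allI impI)
    fix c :: ereal assume "c < 0"
    then have "eventually (\<lambda>x. c < ereal (- e x)) (at w)"
      using order_tendstoD(1)[OF lim] by (simp add: zero_ereal_def)
    moreover have "eventually (\<lambda>x. x \<noteq> w) (at w)"
      by (simp add: eventually_at_filter)
    ultimately show "eventually (\<lambda>x. c < (h x - h w - ereal (- d \<bullet> (x - w))) / ereal (norm (x - w))) (at w)"
      by eventually_elim (use bound less_le_trans in blast)
  qed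
  with fin show ?thesis by (simp add: regular_subdiff_def)
qed

lemma GDERIV_half_sq_dist:
  fixes t :: "'a::real_inner"
  shows "GDERIV (\<lambda>x. \<beta> / 2 * (norm (x - t))\<^sup>2) w :> \<beta> *\<^sub>R (w - t)"
  unfolding gderiv_def power2_norm_eq_inner
  by (auto intro!: derivative_eq_intros simp: inner_commute algebra_simps)

lemma inner_transpose_mult: "w \<bullet> (transpose C *v d) = (C *v w) \<bullet> d"
  for C :: "real^'n^'p"
  by (metis dot_lmul_matrix inner_commute transpose_matrix_vector)

lemma GDERIV_half_sq_dist_matrix:
  fixes C :: "real^'n^'p"
  shows "GDERIV (\<lambda>x. \<beta> / 2 * (norm (C *v x - t))\<^sup>2) w :> transpose C *v (\<beta> *\<^sub>R (C *v w - t))"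
proof -
  have "((\<lambda>x. C *v x) has_derivative (\<lambda>x. C *v x)) (at w)"
    by (rule bounded_linear_imp_has_derivative) (rule matrix_vector_mul_bounded_linear)
  from diff_chain_at[OF this GDERIV_half_sq_dist[of \<beta> t "C *v w", unfolded gderiv_def]]
  show ?thesis
    unfolding gderiv_def o_def inner_transpose_mult .
qed

text \<open>A matrix and its transpose have the same operator norm; the inequality needed here follows
  from the Cauchy-Schwarz estimate of \<open>\<parallel>B\<^sup>T r\<parallel>\<^sup>2 = \<langle>r, B (B\<^sup>T r)\<rangle>\<close> after cancelling a factor
  \<open>\<parallel>B\<^sup>T r\<parallel>\<close>.\<close>

lemma norm_transpose_mult_le:
  fixes B :: "real^'n^'p"
  shows "norm (transpose B *v r) \<le> onorm (\<lambda>\<zeta>. B *v \<zeta>) * norm r"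
proof (cases "transpose B *v r = 0")
  case True
  then show ?thesis
    by (simp add: onorm_pos_le matrix_vector_mul_bounded_linear)
next
  case False
  have "(norm (transpose B *v r))\<^sup>2 = r \<bullet> (B *v (transpose B *v r))"
    unfolding power2_norm_eq_inner inner_transpose_mult by (rule inner_commute)
  also have "\<dots> \<le> norm r * norm (B *v (transpose B *v r))"
    by (rule norm_cauchy_schwarz)
  also have "\<dots> \<le> norm r * (onorm (\<lambda>\<zeta>. B *v \<zeta>) * norm (transpose B *v r))"
    by (intro mult_left_mono onorm matrix_vector_mul_bounded_linear) simp
  finally have "norm (transpose B *v r) * norm (transpose B *v r)
      \<le> (onorm (\<lambda>\<zeta>. B *v \<zeta>) * norm r) * norm (transpose B *v r)"
    by (simp add: power2_eq_square mult_ac)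
  with False show ?thesis by simp
qed

section \<open>The proximal map and the envelope of a smooth function\<close>

lemma grad_eqI:
  assumes "GDERIV (\<lambda>w. real_of_ereal (h w)) x :> D"
  shows "grad h x = D"
  unfolding grad_def
proof (rule the_equality)
  show "GDERIV (\<lambda>w. real_of_ereal (h w)) x :> D" by (rule assms)
next
  fix D' assume "GDERIV (\<lambda>w. real_of_ereal (h w)) x :> D'"
  with assms have "(\<lambda>v. v \<bullet> D') = (\<lambda>v. v \<bullet> D)"
    unfolding gderiv_def by (blast dest: has_derivative_unique)
  then have "(D' - D) \<bullet> D' = (D' - D) \<bullet> D" by meson
  then show "D' = D"
    by (metis inner_diff_right inner_eq_zero_iff right_minus_eq)
qed

lemma grad_prox:
  fixes h :: "'a::real_inner \<Rightarrow> ereal"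
  assumes "L_smooth L h" and w: "w \<in> prox (1 / \<beta>) h s"
  shows "grad h w = - (\<beta> *\<^sub>R (w - s))"
proof -
  define q where "q x = \<beta> / 2 * (norm (x - s))\<^sup>2" for x
  have fin: "\<bar>h x\<bar> \<noteq> \<infinity>" for x
    using assms(1) by (simp add: L_smooth_def)
  obtain D where D: "GDERIV (\<lambda>w. real_of_ereal (h w)) w :> D"
    using assms(1) unfolding L_smooth_def by blast
  have q: "GDERIV q w :> \<beta> *\<^sub>R (w - s)"
    unfolding q_def by (rule GDERIV_half_sq_dist)
  have deriv: "((\<lambda>x. real_of_ereal (h x) + q x) has_derivative
      (\<lambda>v. v \<bullet> D + v \<bullet> (\<beta> *\<^sub>R (w - s)))) (at w)"
    using D q unfolding gderiv_def by (rule has_derivative_add)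
  have "w \<in> argmin (\<lambda>x. h x + ereal (q x))"
    using w by (simp add: prox_def q_def)
  then have min: "h w + ereal (q w - q x) \<le> h x" for x
    unfolding argmin_add_ereal_iff by blast
  have "real_of_ereal (h w) + q w \<le> real_of_ereal (h x) + q x" for x
    using fin[of x] fin[of w] min[of x]
    by (cases "h x"; cases "h w") (auto simp: algebra_simps)
  then have "(\<lambda>v. v \<bullet> D + v \<bullet> (\<beta> *\<^sub>R (w - s))) = (\<lambda>v. 0)"
    by (intro has_derivative_local_min[OF deriv]) simp
  then have "(D + \<beta> *\<^sub>R (w - s)) \<bullet> (D + \<beta> *\<^sub>R (w - s)) = 0"
    unfolding inner_add_right by meson
  then have "D = - (\<beta> *\<^sub>R (w - s))"
    by (simp add: eq_neg_iff_add_eq_0)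
  with grad_eqI[OF D] show ?thesis by simp
qed

text \<open>By the optimality condition \<open>grad h w = - \<beta> (w - s)\<close>, two distinct proximal points would have
  gradients at distance \<open>\<beta>\<close> times their own distance, contradicting the Lipschitz bound
  with \<open>L < \<beta>\<close>.\<close>

lemma prox_eq_singleton:
  fixes h :: "'a::real_inner \<Rightarrow> ereal"
  assumes smooth: "L_smooth L h" and "L < \<beta>" and w: "w \<in> prox (1 / \<beta>) h s"
  shows "prox (1 / \<beta>) h s = {w}"
proof -
  have "w' = w" if w': "w' \<in> prox (1 / \<beta>) h s" for w'
  proof (rule ccontr)
    assume "w' \<noteq> w"
    have "L-lipschitz_on UNIV (grad h)"
      using smooth by (simp add: L_smooth_def)
    then have "norm (grad h w - grad h w') \<le> L * norm (w - w')" and "0 \<le> L"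
      by (auto simp: lipschitz_on_def dist_norm)
    moreover have "grad h w - grad h w' = - (\<beta> *\<^sub>R (w - w'))"
      by (simp add: grad_prox[OF smooth w] grad_prox[OF smooth w'] algebra_simps)
    ultimately have "\<beta> * norm (w - w') \<le> L * norm (w - w')"
      using \<open>L < \<beta>\<close> by simp
    with \<open>w' \<noteq> w\<close> \<open>L < \<beta>\<close> show False by simp
  qed
  with w show ?thesis by blast
qed

text \<open>Since \<open>grad \<phi>1 u = - \<beta> (u - s)\<close>, completing the square in the linearization moves the centre
  of the quadratic from \<open>u\<close> to \<open>u + (u - s) = 2 u - s\<close>. So the proximal point
  \<open>v\<close> of the second step attains the minimum in the envelope.\<close>

lemma dr_envelope_eq:
  fixes \<phi>1 \<phi>2 :: "'a::real_inner \<Rightarrow> ereal"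
  assumes smooth: "L_smooth L \<phi>1" and "L < \<beta>" and "0 < \<beta>"
    and u: "u \<in> prox (1 / \<beta>) \<phi>1 s" and v: "v \<in> prox (1 / \<beta>) \<phi>2 (2 *\<^sub>R u - s)"
  shows "dr_envelope (1 / \<beta>) \<phi>1 \<phi>2 s
    = \<phi>2 v + \<phi>1 u + ereal (\<beta> * ((u - s) \<bullet> (u - v)) + \<beta> / 2 * (norm (u - v))\<^sup>2)"
proof -
  define q where "q w = \<beta> / 2 * (norm (w - (2 *\<^sub>R u - s)))\<^sup>2" for w
  define p where "p w = grad \<phi>1 u \<bullet> (w - u) + \<beta> / 2 * (norm (w - u))\<^sup>2" for w
  have p: "p w = q w - (norm (grad \<phi>1 u))\<^sup>2 / (2 * \<beta>)" for w
    using complete_square[OF \<open>0 < \<beta>\<close>, of "grad \<phi>1 u" "w - u"] \<open>0 < \<beta>\<close>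
    by (simp add: p_def q_def grad_prox[OF smooth u] scaleR_2 algebra_simps)
  have "v \<in> argmin (\<lambda>w. \<phi>2 w + ereal (q w))"
    using v by (simp add: prox_def q_def)
  then have min: "\<bar>\<phi>2 v\<bar> \<noteq> \<infinity>" "\<phi>2 v + ereal (q v - q w) \<le> \<phi>2 w" for w
    unfolding argmin_add_ereal_iff by auto
  have fin: "\<bar>\<phi>1 u\<bar> \<noteq> \<infinity>"
    using smooth by (simp add: L_smooth_def)
  have le: "\<phi>2 v + \<phi>1 u + ereal (p v) \<le> \<phi>2 w + \<phi>1 u + ereal (p w)" for w
    using fin min(1) min(2)[of w] by (cases "\<phi>1 u"; cases "\<phi>2 v"; cases "\<phi>2 w") (auto simp: p)
  have "dr_envelope (1 / \<beta>) \<phi>1 \<phi>2 s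
      = (LEAST t. t \<in> range (\<lambda>w. \<phi>2 w + \<phi>1 u + ereal (p w)))"
    by (simp add: dr_envelope_def prox_eq_singleton[OF smooth \<open>L < \<beta>\<close> u] p_def)
  also have "\<dots> = \<phi>2 v + \<phi>1 u + ereal (p v)"
    by (rule Least_equality) (use le in auto)
  also have "p v = \<beta> * ((u - s) \<bullet> (u - v)) + \<beta> / 2 * (norm (u - v))\<^sup>2"
    unfolding p_def grad_prox[OF smooth u]
    by (simp add: norm_minus_commute inner_diff_right algebra_simps)
  finally show ?thesis .
qed

section \<open>The ADMM subproblems as penalty problems\<close>

lemma coupling_eq_x:
  assumes "\<beta> > 0"
  shows "coupling \<beta> A B b x z y
    = \<beta> / 2 * (norm (A *v x - (b - B *v z - y /\<^sub>R \<beta>)))\<^sup>2 - (norm y)\<^sup>2 / (2 * \<beta>)"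
  unfolding coupling_def complete_square[OF assms] by (simp add: algebra_simps)

lemma coupling_eq_z:
  assumes "\<beta> > 0"
  shows "coupling \<beta> A B b x z y
    = \<beta> / 2 * (norm (B *v z - (b - A *v x - y /\<^sub>R \<beta>)))\<^sup>2 - (norm y)\<^sup>2 / (2 * \<beta>)"
  unfolding coupling_def complete_square[OF assms] by (simp add: algebra_simps)

text \<open>Both branches of the objective differ from the penalty problem by a finite constant: in the
  first the term \<open>g z\<close> is absent, in the second it is finite.\<close>

lemma argmin_aug_lagrangian_x:
  fixes f :: "real^'m \<Rightarrow> ereal" and A :: "real^'m^'p"
  assumes "\<beta> > 0" and "g z \<noteq> -\<infinity>"
  shows "argmin (\<lambda>\<xi>. if g z = \<infinity> then f \<xi> + ereal (coupling \<beta> A B b \<xi> z y)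
                          else aug_lagrangian \<beta> f g A B b \<xi> z y)
    = argmin (\<lambda>\<xi>. f \<xi> + ereal (\<beta> / 2 * (norm (A *v \<xi> - (b - B *v z - y /\<^sub>R \<beta>)))\<^sup>2))"
    (is "?lhs = argmin ?Q")
proof -
  define k where "k = (if g z = \<infinity> then 0 else g z) + ereal (- ((norm y)\<^sup>2 / (2 * \<beta>)))"
  have k: "\<bar>k\<bar> \<noteq> \<infinity>"
    using assms(2) by (cases "g z") (auto simp: k_def)
  have "(if g z = \<infinity> then f \<xi> + ereal (coupling \<beta> A B b \<xi> z y)
          else aug_lagrangian \<beta> f g A B b \<xi> z y) = ?Q \<xi> + k" for \<xi>
    using assms(2) unfolding aug_lagrangian_def coupling_eq_x[OF assms(1)] k_def
    by (cases "g z"; cases "f \<xi>") auto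
  then show ?thesis
    by (simp only: argmin_add_const[OF k])
qed

lemma argmin_aug_lagrangian_z:
  fixes g :: "real^'n \<Rightarrow> ereal" and B :: "real^'n^'p"
  assumes "\<beta> > 0" and "\<bar>f x\<bar> \<noteq> \<infinity>"
  shows "argmin (\<lambda>\<zeta>. aug_lagrangian \<beta> f g A B b x \<zeta> y)
    = argmin (\<lambda>\<zeta>. g \<zeta> + ereal (\<beta> / 2 * (norm (B *v \<zeta> - (b - A *v x - y /\<^sub>R \<beta>)))\<^sup>2))"
    (is "?lhs = argmin ?Q")
proof -
  define k where "k = f x + ereal (- ((norm y)\<^sup>2 / (2 * \<beta>)))"
  have k: "\<bar>k\<bar> \<noteq> \<infinity>"
    using assms(2) by (cases "f x") (auto simp: k_def)
  have "aug_lagrangian \<beta> f g A B b x \<zeta> y = ?Q \<zeta> + k" for \<zeta>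
    using assms(2) unfolding aug_lagrangian_def coupling_eq_z[OF assms(1)] k_def
    by (cases "f x"; cases "g \<zeta>") auto
  then show ?thesis
    by (simp only: argmin_add_const[OF k])
qed

text \<open>Serves to carry the second proximal step from \<open>image_fun B g\<close> over to \<open>\<phi>2\<close>, which is its
  composition with the isometry \<open>w \<mapsto> b - w\<close>.\<close>

lemma prox_reflect:
  fixes h :: "'a::real_normed_vector \<Rightarrow> ereal"
  assumes "b - w \<in> prox \<gamma> h (b - t)"
  shows "w \<in> prox \<gamma> (\<lambda>w. h (b - w)) t"
proof -
  have "norm (b - w' - (b - t)) = norm (w' - t)" for w'
    by (simp add: norm_minus_commute)
  with assms show ?thesis
    unfolding prox_def argmin_def mem_Collect_eq by metis
qed

theorem theorem5p5:
  fixes f :: "real^'m \<Rightarrow> ereal" and g :: "real^'n \<Rightarrow> ereal"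
    and A :: "real^'m^'p" and B :: "real^'n^'p" and b :: "real^'p"
    and lam \<beta> \<gamma> :: real
    and x xp :: "real^'m" and z zp :: "real^'n" and y yp :: "real^'p"
    and s u v sp up vp :: "real^'p"
    and \<phi>1 \<phi>2 :: "real^'p \<Rightarrow> ereal"
  assumes "\<forall>\<xi>. f \<xi> \<noteq> -\<infinity>" and "\<forall>\<zeta>. g \<zeta> \<noteq> -\<infinity>"
    and "lam > 0" and "\<beta> > 0"
    and "\<forall>t. argmin (\<lambda>\<xi>. f \<xi> + ereal (\<beta> / 2 * (norm (A *v \<xi> - t))\<^sup>2)) \<noteq> {}"
    and "\<forall>t. argmin (\<lambda>\<zeta>. g \<zeta> + ereal (\<beta> / 2 * (norm (B *v \<zeta> - t))\<^sup>2)) \<noteq> {}"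
    and "admm_update lam \<beta> f g A B b x z y xp zp yp"
    and "s = A *v x - y /\<^sub>R \<beta>" and "u = A *v x" and "v = b - B *v z"
    and "sp = A *v xp - yp /\<^sub>R \<beta>" and "up = A *v xp" and "vp = b - B *v zp"
    and "\<phi>1 = image_fun A f" and "\<phi>2 = (\<lambda>w. image_fun B g (b - w))" and "\<gamma> = 1 / \<beta>"
  shows "sp = s + lam *\<^sub>R (v - u) \<and> up \<in> prox \<gamma> \<phi>1 sp \<and> vp \<in> prox \<gamma> \<phi>2 (2 *\<^sub>R up - sp)
    \<and> (\<phi>1 up = image_fun A f (A *v xp) \<and> image_fun A f (A *v xp) = f xp)
    \<and> (\<phi>2 vp = image_fun B g (B *v zp) \<and> image_fun B g (B *v zp) = g zp)
    \<and> (- yp \<in> regular_subdiff \<phi>1 up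
        \<and> regular_subdiff \<phi>1 up = regular_subdiff (image_fun A f) (A *v xp))
    \<and> - (transpose A *v yp) \<in> regular_subdiff f xp
    \<and> edist_set (- (transpose B *v yp)) (regular_subdiff g zp)
        \<le> ereal (\<beta> * onorm (\<lambda>\<zeta>. B *v \<zeta>) * norm (A *v xp + B *v zp - b))
    \<and> (\<forall>L. rank A = CARD('p) \<and> L_smooth L \<phi>1 \<and> \<beta> > L \<longrightarrow>
        dr_envelope \<gamma> \<phi>1 \<phi>2 sp = aug_lagrangian \<beta> f g A B b xp zp yp)"
proof -
  note beta = \<open>\<beta> > 0\<close>
  obtain y2 where y2: "y2 = y - (\<beta> * (1 - lam)) *\<^sub>R (A *v x + B *v z - b)"
    and xp: "xp \<in> argmin (\<lambda>\<xi>. if g z = \<infinity> then f \<xi> + ereal (coupling \<beta> A B b \<xi> z y2)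
                          else aug_lagrangian \<beta> f g A B b \<xi> z y2)"
    and yp: "yp = y2 + \<beta> *\<^sub>R (A *v xp + B *v z - b)"
    and zp: "zp \<in> argmin (\<lambda>\<zeta>. aug_lagrangian \<beta> f g A B b xp \<zeta> yp)"
    using assms(7) unfolding admm_update_def by blast
  \<comment> \<open>The new residual in \<open>yp\<close> cancels \<open>A *v xp\<close>, so \<open>sp\<close> is fixed by the old iterate and
    is the target of the \<open>x\<close>-subproblem.\<close>
  have sp: "sp = b - B *v z - y2 /\<^sub>R \<beta>"
    using beta by (simp add: assms(11) yp algebra_simps)
  have s_step: "sp = s + lam *\<^sub>R (v - u)"
  proof -
    have cancel: "\<beta> * (a * inverse \<beta>) = a" for a
      using beta by simp
    show ?thesis
      using beta by (simp add: sp y2 assms(8,9,10) algebra_simps cancel)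
  qed
  have yp_eq: "yp = \<beta> *\<^sub>R (A *v xp - sp)"
    using beta by (simp add: assms(11))
  have xmin: "xp \<in> argmin (\<lambda>\<xi>. f \<xi> + ereal (\<beta> / 2 * (norm (A *v \<xi> - sp))\<^sup>2))"
    using xp assms(2) unfolding sp by (subst (asm) argmin_aug_lagrangian_x[OF beta]) auto
  then have f_fin: "\<bar>f xp\<bar> \<noteq> \<infinity>"
    unfolding argmin_add_ereal_iff by (rule conjunct1)
  \<comment> \<open>The target of the \<open>z\<close>-subproblem is the reflected point \<open>2 up - sp\<close>, because
    \<open>yp / \<beta> = up - sp\<close>.\<close>
  have "b - A *v xp - yp /\<^sub>R \<beta> = b - (2 *\<^sub>R up - sp)"
    by (simp add: assms(11,12) scaleR_2)
  then have zmin: "zp \<in> argmin (\<lambda>\<zeta>. g \<zeta> + ereal (\<beta> / 2 * (norm (B *v \<zeta> - (b - (2 *\<^sub>R up - sp))))\<^sup>2))"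
    using zp unfolding argmin_aug_lagrangian_z[where f = f and x = xp, OF beta f_fin] by (simp only:)
  have up_min: "up \<in> argmin (\<lambda>t. \<phi>1 t + ereal (\<beta> / 2 * (norm (t - sp))\<^sup>2))"
    unfolding assms(12,14)
    by (rule image_argmin[where q = "\<lambda>t. \<beta> / 2 * (norm (t - sp))\<^sup>2", OF xmin])
  then have up_prox: "up \<in> prox \<gamma> \<phi>1 sp"
    by (simp add: prox_def assms(16))
  have "B *v zp \<in> prox \<gamma> (image_fun B g) (b - (2 *\<^sub>R up - sp))"
    using image_argmin[where q = "\<lambda>t. \<beta> / 2 * (norm (t - (b - (2 *\<^sub>R up - sp))))\<^sup>2", OF zmin]
    by (simp add: prox_def assms(16))
  then have vp_prox: "vp \<in> prox \<gamma> \<phi>2 (2 *\<^sub>R up - sp)"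
    unfolding assms(15) by (intro prox_reflect) (simp add: assms(13))
  have f_val: "image_fun A f (A *v xp) = f xp"
    by (rule image_fun_eq_at_argmin[where q = "\<lambda>t. \<beta> / 2 * (norm (t - sp))\<^sup>2", OF xmin])
  have g_val: "image_fun B g (B *v zp) = g zp"
    by (rule image_fun_eq_at_argmin
        [where q = "\<lambda>t. \<beta> / 2 * (norm (t - (b - (2 *\<^sub>R up - sp))))\<^sup>2", OF zmin])
  have phi2_vp: "\<phi>2 vp = image_fun B g (B *v zp)"
    by (simp add: assms(13,15))
  have sub1: "- yp \<in> regular_subdiff \<phi>1 up"
    using regular_subdiff_argmin[OF up_min GDERIV_half_sq_dist] by (simp add: yp_eq assms(12))
  have sub_f: "- (transpose A *v yp) \<in> regular_subdiff f xp"
    using regular_subdiff_argmin[OF xmin GDERIV_half_sq_dist_matrix] by (simp add: yp_eq)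
  define r where "r = A *v xp + B *v zp - b"
  \<comment> \<open>The dual update used the residual with the old \<open>z\<close>, so optimality of \<open>zp\<close> yields a
    subgradient for \<open>yp\<close> shifted by \<open>\<beta>\<close> times the new residual.\<close>
  have "\<beta> *\<^sub>R (B *v zp - (b - (2 *\<^sub>R up - sp))) = yp + \<beta> *\<^sub>R r"
    by (simp add: yp_eq assms(12) r_def scaleR_2 algebra_simps)
  then have sub_g: "- (transpose B *v (yp + \<beta> *\<^sub>R r)) \<in> regular_subdiff g zp"
    using regular_subdiff_argmin[OF zmin GDERIV_half_sq_dist_matrix] by simp
  have "edist_set (- (transpose B *v yp)) (regular_subdiff g zp)
      \<le> ereal (dist (- (transpose B *v yp)) (- (transpose B *v (yp + \<beta> *\<^sub>R r))))"
    unfolding edist_set_def by (rule INF_lower[OF sub_g])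
  also have "\<dots> = ereal (\<beta> * norm (transpose B *v r))"
    using beta by (simp add: dist_norm matrix_vector_right_distrib matrix_vector_mult_scaleR)
  also have "\<dots> \<le> ereal (\<beta> * onorm (\<lambda>\<zeta>. B *v \<zeta>) * norm r)"
    using beta norm_transpose_mult_le[of B r] by (simp add: mult.assoc)
  finally have dist_g: "edist_set (- (transpose B *v yp)) (regular_subdiff g zp)
      \<le> ereal (\<beta> * onorm (\<lambda>\<zeta>. B *v \<zeta>) * norm (A *v xp + B *v zp - b))"
    unfolding r_def .
  have env: "dr_envelope \<gamma> \<phi>1 \<phi>2 sp = aug_lagrangian \<beta> f g A B b xp zp yp"
    if "L_smooth L \<phi>1" and "\<beta> > L" for L
  proof -
    have r: "up - vp = A *v xp + B *v zp - b"
      by (simp add: assms(12,13))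
    have y: "\<beta> * ((up - sp) \<bullet> w) = yp \<bullet> w" for w
      by (simp add: yp_eq assms(12))
    have "dr_envelope \<gamma> \<phi>1 \<phi>2 sp = \<phi>2 vp + \<phi>1 up
        + ereal (\<beta> * ((up - sp) \<bullet> (up - vp)) + \<beta> / 2 * (norm (up - vp))\<^sup>2)"
      using dr_envelope_eq[OF that beta, of up sp vp \<phi>2] up_prox vp_prox by (simp add: assms(16))
    also have "\<dots> = aug_lagrangian \<beta> f g A B b xp zp yp"
      unfolding y r phi2_vp g_val aug_lagrangian_def coupling_def
      by (simp add: assms(12,14) f_val add.commute)
    finally show ?thesis .
  qed
  show ?thesis
  proof (intro conjI allI impI)
    show "\<phi>1 up = image_fun A f (A *v xp)"
      and "regular_subdiff \<phi>1 up = regular_subdiff (image_fun A f) (A *v xp)"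
      by (simp_all add: assms(12,14))
  qed (use s_step up_prox vp_prox f_val g_val phi2_vp sub1 sub_f dist_g env in blast)+
qed

end
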